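(* Consider the fully composite problem $\varphi^*=\min_{x\in\operatorname{dom}\varphi}\{\varphi(x)=F(x,f(x))\}$ with subhomogeneous outer function (see context), where each component of $f$ is convex and continuously differentiable with Lipschitz continuous gradient, and $F(L_1(f))<+\infty$. Let $\operatorname{dom}\varphi$ be a bounded convex set, with diameter $$\mathscr{D}=\sup_{x,y\in\operatorname{dom}\varphi}\|x-y\|<+\infty.$$ Let $x_0\in\operatorname{dom}\varphi$, $\gamma_k=\frac{2}{k+2}$, and let $\{x_k\}$ be generated by the Contracting Conditional Gradient Method $$x_{k+1}\in\operatorname*{argmin}_{y}\Big\{F\big(y,\ f(x_k)+\langle\nabla f(x_k),y-x_k\rangle\big):\ x_k+\tfrac1{\gamma_k}(y-x_k)\in\operatorname{dom}\varphi\Big\},\qquad k\ge0$$ (minimizers are assumed to exist). Then for all $k\ge1$, $$\varphi(x_k)-\varphi^*\ \le\ \frac{4F(L_1(f))\mathscr{D}^2}{k}.$$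
   Context: $\mathbb{E}$ is a finite-dimensional real vector space with norm $\|x\|=\langle Bx,x\rangle^{1/2}$, where $B:\mathbb{E}\to\mathbb{E}^*$ is self-adjoint positive definite, and dual norm $\|g\|_*=\langle g,B^{-1}g\rangle^{1/2}$. Fully composite problem: $F:\mathbb{E}\times\mathbb{R}^m\to\mathbb{R}\cup\{+\infty\}$ is closed and convex, and for every $x$ the function $F(x,\cdot)$ is monotone: $u\le v$ componentwise implies $F(x,u)\le F(x,v)$. $f=(f_1,\dots,f_m)^T:\operatorname{dom} f\to\mathbb{R}^m$ with $\operatorname{dom} f\subseteq\mathbb{E}$ open convex, and all $f_i$ closed and convex. $\varphi(x)=F(x,f(x))$, $\operatorname{dom}\varphi=\{x\in\operatorname{dom} f:F(x,f(x))<+\infty\}$, and a minimizer $x^*$ with $\varphi(x^* )=\varphi^*$ is assumed to exist. Subhomogeneity: for every $x\in\operatorname{dom}\varphi$, $F(x,\cdot)$ is finite on all of $\mathbb{R}^m$ and $F(x,u+tv)\le F(x,u)+tF(x,v)$ for all $u,v\in\mathbb{R}^m$, $t\ge0$. $\langle\nabla f(x),h\rangle$ denotes the vector $(\langle\nabla f_i(x),h\rangle)_{i=1}^m$. $L_1(f_i)<+\infty$ is a constant with $\|\nabla f_i(x)-\nabla f_i(y)\|_*\le L_1(f_i)\|x-y\|$ on $\operatorname{dom} f$; $L_1(f)=(L_1(f_1),\dots,L_1(f_m))^T$. Notation: $F(L_1(f))=\sup_{x\in\operatorname{dom}\varphi}F(x,L_1(f))$. *)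

theory Defs
  imports "HOL-Analysis.Analysis"
begin

text \<open>
  The space is a Euclidean space type whose built-in norm only supplies the canonical topology of a
  finite-dimensional space. Its dual is \<open>'a \<Rightarrow>\<^sub>L real\<close>, and all metric quantities are
  measured in the norm given by \<open>B\<close> and the corresponding dual norm.
\<close>

definition self_adjoint_pos_def :: "('a::euclidean_space \<Rightarrow>\<^sub>L ('a \<Rightarrow>\<^sub>L real)) \<Rightarrow> bool" where
  "self_adjoint_pos_def B \<longleftrightarrow>
     (\<forall>x y. blinfun_apply (B x) y = blinfun_apply (B y) x) \<and>
     (\<forall>x. x \<noteq> 0 \<longrightarrow> 0 < blinfun_apply (B x) x)"

definition primal_norm :: "('a::euclidean_space \<Rightarrow>\<^sub>L ('a \<Rightarrow>\<^sub>L real)) \<Rightarrow> 'a \<Rightarrow> real" where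
  "primal_norm B x = sqrt (blinfun_apply (B x) x)"

definition dual_norm :: "('a::euclidean_space \<Rightarrow>\<^sub>L ('a \<Rightarrow>\<^sub>L real)) \<Rightarrow> ('a \<Rightarrow>\<^sub>L real) \<Rightarrow> real" where
  "dual_norm B g = sqrt (blinfun_apply g (inv (blinfun_apply B) g))"

text \<open>Closedness and convexity of an extended-valued function, through its epigraph over the reals
  (the library's \<open>epigraph\<close> is restricted to real-valued functions).\<close>

definition ext_epigraph :: "('b \<Rightarrow> ereal) \<Rightarrow> ('b \<times> real) set" where
  "ext_epigraph G = {(z, t). G z \<le> ereal t}"

definition closed_convex_ext :: "('b::real_normed_vector \<Rightarrow> ereal) \<Rightarrow> bool" where
  "closed_convex_ext G \<longleftrightarrow> closed (ext_epigraph G) \<and> convex (ext_epigraph G)"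

text \<open>In the following, \<open>X\<close> is the domain of the inner map \<open>f\<close>; the objective is
  extended by \<open>\<infinity>\<close> outside of \<open>X\<close>, where \<open>f\<close> has no meaningful value.\<close>

definition fc_obj :: "('a \<times> (real^'m) \<Rightarrow> ereal) \<Rightarrow> ('a \<Rightarrow> real^'m) \<Rightarrow> 'a set \<Rightarrow> 'a \<Rightarrow> ereal" where
  "fc_obj F f X x = (if x \<in> X then F (x, f x) else \<infinity>)"

definition fc_dom :: "('a \<times> (real^'m) \<Rightarrow> ereal) \<Rightarrow> ('a \<Rightarrow> real^'m) \<Rightarrow> 'a set \<Rightarrow> 'a set" where
  "fc_dom F f X = {x \<in> X. F (x, f x) < \<infinity>}"

definition subhomogeneous_on :: "'a set \<Rightarrow> ('a \<times> (real^'m) \<Rightarrow> ereal) \<Rightarrow> bool" where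
  "subhomogeneous_on S F \<longleftrightarrow>
     (\<forall>x\<in>S. (\<forall>u. \<bar>F (x, u)\<bar> \<noteq> \<infinity>) \<and>
       (\<forall>u v t. 0 \<le> t \<longrightarrow> F (x, u + t *\<^sub>R v) \<le> F (x, u) + ereal t * F (x, v)))"

definition set_diameter :: "('a::euclidean_space \<Rightarrow>\<^sub>L ('a \<Rightarrow>\<^sub>L real)) \<Rightarrow> 'a set \<Rightarrow> ereal" where
  "set_diameter B S = (SUP x\<in>S. SUP y\<in>S. ereal (primal_norm B (x - y)))"

text \<open>The linearization of \<open>f\<close> at \<open>x\<close>, evaluated at \<open>y\<close>; \<open>g i\<close> is the
  gradient of the \<open>i\<close>-th component.\<close>

definition linearization ::
  "('a::euclidean_space \<Rightarrow> real^'m) \<Rightarrow> ('m \<Rightarrow> 'a \<Rightarrow> ('a \<Rightarrow>\<^sub>L real)) \<Rightarrow> 'a \<Rightarrow> 'a \<Rightarrow> real^'m" where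
  "linearization f g x y = f x + (\<chi> i. blinfun_apply (g i x) (y - x))"

definition ccg_step :: "nat \<Rightarrow> real" where
  "ccg_step k = 2 / (real k + 2)"

definition contracting_cond_grad ::
  "('a::euclidean_space \<times> (real^'m) \<Rightarrow> ereal) \<Rightarrow> ('a \<Rightarrow> real^'m) \<Rightarrow> ('m \<Rightarrow> 'a \<Rightarrow> ('a \<Rightarrow>\<^sub>L real))
     \<Rightarrow> 'a set \<Rightarrow> (nat \<Rightarrow> 'a) \<Rightarrow> bool" where
  "contracting_cond_grad F f g X x \<longleftrightarrow>
     x 0 \<in> fc_dom F f X \<and>
     (\<forall>k. is_arg_min (\<lambda>y. F (y, linearization f g (x k) y))
                     (\<lambda>y. x k + (1 / ccg_step k) *\<^sub>R (y - x k) \<in> fc_dom F f X)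
                     (x (Suc k)))"

end

theory Submission
  imports Defs
begin

text \<open>
  Write \<open>\<phi>\<close> for the objective, \<open>\<delta>\<^sub>k = \<phi> (x\<^sub>k) - \<phi>\<^sup>*\<close>, \<open>C\<close> for the supremum
  of \<open>F (z, L1)\<close> over the domain and \<open>D\<close> for the diameter. The reason for the rate is that one
  step contracts \<open>\<delta>\<close> up to an error of second order in the step size \<open>\<gamma>\<close>:
  \<open>\<delta>\<^sub>k\<^sub>+\<^sub>1 \<le> (1 - \<gamma>) \<delta>\<^sub>k + \<gamma>\<^sup>2 / 2 \<cdot> C D\<^sup>2\<close>.

  The error term is the price for replacing \<open>f\<close> by its linearization. The next iterate has the form
  \<open>(1 - \<gamma>) x\<^sub>k + \<gamma> w\<close> with \<open>w\<close> in the domain, so it moves by at most \<open>\<gamma> D\<close>, and the quadratic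
  upper bound for functions with Lipschitz gradient (\<open>lipschitz_gradient_upper_bound\<close>) exceeds the
  linearization by at most \<open>(\<gamma> D)\<^sup>2 / 2\<close> times \<open>L1\<close>. Monotonicity and subhomogeneity of the outer
  function carry this vector error through \<open>F\<close> and turn it into \<open>C (\<gamma> D)\<^sup>2 / 2\<close>.

  The contraction comes from comparing the iterate with the feasible competitor
  \<open>(1 - \<gamma>) x\<^sub>k + \<gamma> x\<^sup>*\<close>. There the linearization lies below \<open>f\<close>
  (\<open>convex_on_above_tangent_blinfun\<close>), so the model value is at most that of \<open>\<phi>\<close>, and
  \<open>\<phi>\<close> is convex because \<open>F\<close> is jointly convex and monotone in its second argument
  (\<open>monotone_composite_convex\<close>).

  For \<open>\<gamma> = 2 / (k + 2)\<close> the factor \<open>1 - \<gamma>\<close> is \<open>k / (k + 2)\<close>, so multiplying by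
  \<open>(k + 1) (k + 2)\<close> makes the recursion telescope (\<open>contracting_recursion_bound\<close>). This gives
  \<open>\<delta>\<^sub>k \<le> 2 C D\<^sup>2 / (k + 1)\<close>, which is stronger than the claim since \<open>C \<ge> 0\<close>.
\<close>

section \<open>The norm of a positive definite operator and its dual\<close>

lemma Cauchy_Schwarz_pos_def:
  assumes "self_adjoint_pos_def B"
  shows "blinfun_apply (B p) v \<le> primal_norm B p * primal_norm B v"
proof (cases "v = 0")
  case True
  then show ?thesis by (simp add: primal_norm_def)
next
  case False
  have sym: "\<And>x y. B x y = B y x"
    and pos: "\<And>x. x \<noteq> 0 \<Longrightarrow> 0 < B x x"
    using assms by (auto simp: self_adjoint_pos_def_def)
  have nonneg: "0 \<le> B x x" for x
    using pos[of x] by (cases "x = 0") auto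
  have v: "0 < B v v" using pos False by blast
  \<comment> \<open>\<open>t v\<close> is the orthogonal projection of \<open>p\<close> onto the line through \<open>v\<close>.\<close>
  define t where "t = B p v / B v v"
  have "0 \<le> B (p - t *\<^sub>R v) (p - t *\<^sub>R v)" by (rule nonneg)
  also have "\<dots> = B p p - 2 * t * B p v + t * t * B v v"
    by (simp add: blinfun.bilinear_simps sym[of v p] algebra_simps)
  also have "\<dots> = B p p - (B p v)\<^sup>2 / B v v"
    using v by (simp add: t_def field_simps power2_eq_square)
  finally have "(B p v)\<^sup>2 \<le> B p p * B v v"
    using v by (simp add: field_simps)
  then have "\<bar>B p v\<bar> \<le> sqrt (B p p * B v v)"
    by (metis real_sqrt_abs real_sqrt_le_iff)
  then show ?thesis
    by (simp add: primal_norm_def real_sqrt_mult)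
qed

lemma bij_pos_def:
  fixes B :: "'a::euclidean_space \<Rightarrow>\<^sub>L ('a \<Rightarrow>\<^sub>L real)"
  assumes "self_adjoint_pos_def B"
  shows "bij (blinfun_apply B)"
proof -
  have pos: "\<And>x. x \<noteq> 0 \<Longrightarrow> 0 < B x x"
    using assms by (auto simp: self_adjoint_pos_def_def)
  have inj: "inj (blinfun_apply B)"
  proof (rule injI)
    fix x y assume "B x = B y"
    then have "B (x - y) (x - y) = 0" by (simp add: blinfun.bilinear_simps)
    then show "x = y" using pos[of "x - y"] by force
  qed
  \<comment> \<open>Identifying functionals with their coordinate vectors makes \<open>B\<close> an endomorphism of a
    finite-dimensional space, for which injectivity implies surjectivity.\<close>
  define R :: "('a \<Rightarrow>\<^sub>L real) \<Rightarrow> 'a" where "R h = (\<Sum>b\<in>Basis. h b *\<^sub>R b)" for h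
  have R_inner: "R h \<bullet> b = h b" if "b \<in> Basis" for h b
    using that by (simp add: R_def inner_sum_left_Basis)
  have inj_R: "h = h'" if "R h = R h'" for h h'
    by (rule blinfun_euclidean_eqI) (metis R_inner that)
  have "linear (\<lambda>x. R (B x))"
    by (rule linearI)
      (simp_all add: R_def blinfun.bilinear_simps scaleR_left_distrib sum.distrib scaleR_sum_right)
  moreover have "inj (\<lambda>x. R (B x))"
    using inj inj_R by (auto simp: inj_def)
  ultimately have "surj (\<lambda>x. R (B x))"
    by (rule linear_inj_imp_surj)
  then have "\<exists>x. R (B x) = R h" for h
    by (metis surjD)
  then have "\<exists>x. B x = h" for h
    by (rule ex_forward) (rule inj_R)
  then have "surj (blinfun_apply B)"
    unfolding surj_def by metis
  with inj show ?thesis by (simp add: bij_def)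
qed

text \<open>Every functional is \<open>B p\<close> for some \<open>p\<close>, and its dual norm is the norm of \<open>p\<close>; so the
  pairing of primal and dual norm is the Cauchy-Schwarz inequality.\<close>

lemma dual_norm_pairing:
  assumes "self_adjoint_pos_def B"
  shows "blinfun_apply h v \<le> dual_norm B h * primal_norm B v"
proof -
  obtain p where p: "h = B p"
    using bij_pos_def[OF assms] by (metis bij_pointE)
  have "dual_norm B h = primal_norm B p"
    using bij_pos_def[OF assms] by (simp add: dual_norm_def primal_norm_def p bij_is_inj)
  then show ?thesis
    using Cauchy_Schwarz_pos_def[OF assms] p by simp
qed

lemma primal_norm_nonneg:
  assumes "self_adjoint_pos_def B"
  shows "0 \<le> primal_norm B v"
  using assms by (cases "v = 0") (auto simp: self_adjoint_pos_def_def primal_norm_def less_imp_le)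

lemma primal_norm_pos:
  assumes "self_adjoint_pos_def B" "v \<noteq> 0"
  shows "0 < primal_norm B v"
  using assms by (simp add: self_adjoint_pos_def_def primal_norm_def)

lemma primal_norm_scaleR:
  "primal_norm B (c *\<^sub>R v) = \<bar>c\<bar> * primal_norm B v"
proof -
  have "B (c *\<^sub>R v) (c *\<^sub>R v) = c\<^sup>2 * B v v"
    by (simp add: blinfun.bilinear_simps power2_eq_square)
  then show ?thesis
    by (simp add: primal_norm_def real_sqrt_mult)
qed

lemma dual_norm_nonneg:
  assumes "self_adjoint_pos_def B"
  shows "0 \<le> dual_norm B h"
proof -
  obtain v :: 'a where v: "v \<noteq> 0" using nonzero_Basis nonempty_Basis by blast
  have "h v \<le> dual_norm B h * primal_norm B v" "h (- v) \<le> dual_norm B h * primal_norm B (- v)"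
    using dual_norm_pairing[OF assms] by blast+
  moreover have "primal_norm B (- v) = primal_norm B v"
    using primal_norm_scaleR[of B "-1" v] by simp
  ultimately have "0 \<le> dual_norm B h * primal_norm B v"
    by (simp add: blinfun.bilinear_simps)
  then show ?thesis
    using primal_norm_pos[OF assms v] by (simp add: zero_le_mult_iff)
qed

text \<open>The space has more than one point, so a Lipschitz bound on a nonempty open set
  compares two distinct points there; this fixes the sign of the constant.\<close>

lemma lipschitz_constant_nonneg:
  assumes B: "self_adjoint_pos_def (B :: 'a::euclidean_space \<Rightarrow>\<^sub>L ('a \<Rightarrow>\<^sub>L real))"
    and X: "open X" "X \<noteq> {}"
    and lip: "\<And>z y. z \<in> X \<Longrightarrow> y \<in> X \<Longrightarrow> dual_norm B (g z - g y) \<le> L * primal_norm B (z - y)"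
  shows "0 \<le> L"
proof -
  obtain z where z: "z \<in> X" using X by blast
  obtain y where y: "y \<in> X" "y \<noteq> z"
    using islimpt_UNIV[of z] X z unfolding islimpt_def by blast
  have "0 \<le> dual_norm B (g y - g z)" by (rule dual_norm_nonneg[OF B])
  also have "\<dots> \<le> L * primal_norm B (y - z)" by (rule lip[OF y(1) z])
  finally show ?thesis
    using primal_norm_pos[OF B, of "y - z"] y by (simp add: zero_le_mult_iff)
qed

section \<open>First-order bounds for convex functions with Lipschitz gradient\<close>

lemma has_real_derivative_along_line:
  fixes x v :: "'a::real_normed_vector"
  assumes "(h has_derivative blinfun_apply D) (at (x + t *\<^sub>R v))"
  shows "((\<lambda>s. h (x + s *\<^sub>R v)) has_real_derivative D v) (at t)"
proof -
  have "((\<lambda>s. x + s *\<^sub>R v) has_derivative (\<lambda>s. s *\<^sub>R v)) (at t)"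
    by (auto intro!: derivative_eq_intros)
  from has_derivative_compose[OF this assms]
  show ?thesis
    by (simp add: has_field_derivative_def blinfun.bilinear_simps mult.commute[of _ "D v"])
qed

text \<open>Along the segment from \<open>x\<close> to \<open>y\<close> the derivative of \<open>h\<close> grows at most linearly, with slope
  \<open>L\<close> times the squared length, so \<open>h\<close> minus the quadratic bound is nonincreasing.\<close>

lemma lipschitz_gradient_upper_bound:
  fixes h :: "'a::euclidean_space \<Rightarrow> real"
  assumes B: "self_adjoint_pos_def B" and X: "convex X"
    and der: "\<And>z. z \<in> X \<Longrightarrow> (h has_derivative blinfun_apply (g z)) (at z)"
    and lip: "\<And>z y. z \<in> X \<Longrightarrow> y \<in> X \<Longrightarrow> dual_norm B (g z - g y) \<le> L * primal_norm B (z - y)"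
    and xy: "x \<in> X" "y \<in> X"
  shows "h y \<le> h x + blinfun_apply (g x) (y - x) + L / 2 * (primal_norm B (y - x))\<^sup>2"
proof -
  define v where "v = y - x"
  define n where "n = primal_norm B v"
  define q where "q t = h (x + t *\<^sub>R v) - t * g x v - L / 2 * t\<^sup>2 * n\<^sup>2" for t :: real
  have "q 1 \<le> q 0"
  proof (rule DERIV_nonpos_imp_nonincreasing[where f = q])
    fix t :: real assume t: "0 \<le> t" "t \<le> 1"
    have "(1 - t) *\<^sub>R x + t *\<^sub>R y \<in> X"
      using X xy t by (simp add: convexD)
    then have inX: "x + t *\<^sub>R v \<in> X" by (simp add: v_def algebra_simps)
    let ?d = "g (x + t *\<^sub>R v) v - g x v - L * t * n\<^sup>2"
    have "(q has_real_derivative ?d) (at t)"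
      unfolding q_def
      by (rule derivative_eq_intros has_real_derivative_along_line[OF der[OF inX]] refl | simp)+
    moreover have "?d \<le> 0"
    proof -
      have "g (x + t *\<^sub>R v) v - g x v \<le> dual_norm B (g (x + t *\<^sub>R v) - g x) * n"
        using dual_norm_pairing[OF B, of "g (x + t *\<^sub>R v) - g x" v]
        by (simp add: blinfun.bilinear_simps n_def)
      also have "\<dots> \<le> L * primal_norm B (x + t *\<^sub>R v - x) * n"
        by (intro mult_right_mono lip inX xy) (simp add: n_def primal_norm_nonneg[OF B])
      also have "\<dots> = L * t * n\<^sup>2"
        using t by (simp add: primal_norm_scaleR n_def power2_eq_square)
      finally show ?thesis by simp
    qed
    ultimately show "\<exists>d. (q has_real_derivative d) (at t) \<and> d \<le> 0" by blast
  qed simp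
  then show ?thesis by (simp add: q_def v_def n_def)
qed

text \<open>Restriction to a line through \<open>x\<close> reduces this to the one-dimensional tangent inequality.\<close>

lemma convex_on_above_tangent_blinfun:
  fixes h :: "'a::euclidean_space \<Rightarrow> real"
  assumes X: "open X" and conv: "convex_on X h"
    and der: "(h has_derivative blinfun_apply D) (at x)"
    and xy: "x \<in> X" "y \<in> X"
  shows "h x + blinfun_apply D (y - x) \<le> h y"
proof -
  define l where "l = (\<lambda>t. x + t *\<^sub>R (y - x))"
  have l_affine: "l ((1 - s) * a + s * b) = (1 - s) *\<^sub>R l a + s *\<^sub>R l b" for s a b
    by (simp add: l_def algebra_simps)
  have cX: "convex X" using conv by (rule convex_on_imp_convex)
  have op: "open (l -` X)"
    unfolding l_def by (intro open_vimage X continuous_intros)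
  have cv: "convex (l -` X)"
    using cX by (auto simp: convex_alt l_affine)
  have "convex_on (l -` X) (\<lambda>t. h (l t))"
  proof (rule convex_onI)
    fix s a b :: real
    assume "0 < s" "s < 1" "a \<in> l -` X" "b \<in> l -` X"
    then show "h (l ((1 - s) *\<^sub>R a + s *\<^sub>R b)) \<le> (1 - s) * h (l a) + s * h (l b)"
      using convex_onD[OF conv, of s "l a" "l b"] by (simp add: l_affine)
  qed (rule cv)
  moreover have "connected (l -` X)" by (rule convex_connected[OF cv])
  moreover have "0 \<in> interior (l -` X)" "1 \<in> l -` X"
    using op xy by (auto simp: interior_open l_def)
  moreover have "((\<lambda>t. h (l t)) has_real_derivative D (y - x)) (at 0 within l -` X)"
    unfolding l_def
    by (rule has_field_derivative_at_within, rule has_real_derivative_along_line) (simp add: der)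
  ultimately have "D (y - x) * (1 - 0) \<le> h (l 1) - h (l 0)"
    by (rule convex_on_imp_above_tangent)
  then show ?thesis by (simp add: l_def)
qed

section \<open>The composite objective\<close>

lemma convex_epigraph_combination:
  assumes "convex (ext_epigraph G)" "G z \<le> ereal a" "G w \<le> ereal b" "0 \<le> t" "t \<le> 1"
  shows "G ((1 - t) *\<^sub>R z + t *\<^sub>R w) \<le> ereal ((1 - t) * a + t * b)"
  using convexD_alt[OF assms(1), of "(z, a)" "(w, b)" t] assms(2-)
  by (simp add: ext_epigraph_def)

lemma monotone_composite_convex:
  fixes F :: "'a::real_normed_vector \<times> (real^'m) \<Rightarrow> ereal" and f :: "'a \<Rightarrow> real^'m"
  assumes F: "convex (ext_epigraph F)"
    and mono: "\<And>z u v. (\<forall>i. u $ i \<le> v $ i) \<Longrightarrow> F (z, u) \<le> F (z, v)"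
    and f: "\<And>i. convex_on X (\<lambda>z. f z $ i)"
    and zw: "z \<in> X" "w \<in> X" and t: "0 \<le> t" "t \<le> 1"
    and ab: "F (z, f z) \<le> ereal a" "F (w, f w) \<le> ereal b"
  shows "F ((1 - t) *\<^sub>R z + t *\<^sub>R w, f ((1 - t) *\<^sub>R z + t *\<^sub>R w)) \<le> ereal ((1 - t) * a + t * b)"
proof -
  let ?y = "(1 - t) *\<^sub>R z + t *\<^sub>R w"
  have "F (?y, f ?y) \<le> F (?y, (1 - t) *\<^sub>R f z + t *\<^sub>R f w)"
    using convex_onD[OF f t(1,2) zw] by (intro mono) simp
  also have "\<dots> \<le> ereal ((1 - t) * a + t * b)"
    using convex_epigraph_combination[OF F ab t] by simp
  finally show ?thesis .
qed

text \<open>Subhomogeneity at \<open>u = v = 0\<close> reads \<open>F (z, 0) \<le> 2 F (z, 0)\<close>.\<close>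

lemma subhomogeneous_nonneg:
  fixes F :: "'a \<times> (real^'m) \<Rightarrow> ereal"
  assumes sub: "subhomogeneous_on S F" and z: "z \<in> S"
    and mono: "\<And>z u v. (\<forall>i. u $ i \<le> v $ i) \<Longrightarrow> F (z, u) \<le> F (z, v)"
    and v: "\<And>i. 0 \<le> v $ i"
  shows "0 \<le> F (z, v)"
proof -
  have "\<bar>F (z, 0)\<bar> \<noteq> \<infinity>" using sub z by (simp add: subhomogeneous_on_def)
  then obtain r where r: "F (z, 0) = ereal r" by auto
  have "F (z, 0 + 1 *\<^sub>R 0) \<le> F (z, 0) + ereal 1 * F (z, 0)"
    using sub z unfolding subhomogeneous_on_def by (metis zero_le_one)
  then have "0 \<le> F (z, 0)" by (simp add: r)
  also have "\<dots> \<le> F (z, v)" using v by (intro mono) simp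
  finally show ?thesis .
qed

lemma fc_dom_finite:
  assumes "subhomogeneous_on (fc_dom F f X) F" "z \<in> fc_dom F f X"
  shows "fc_obj F f X z = ereal (real_of_ereal (fc_obj F f X z))"
    and "F (z, f z) = fc_obj F f X z"
  using assms by (auto simp: subhomogeneous_on_def fc_dom_def fc_obj_def ereal_real)

section \<open>The contracting recursion\<close>

text \<open>Since \<open>1 - 2 / (k + 2) = k / (k + 2)\<close>, the quantities \<open>k (k + 1) \<delta>\<^sub>k\<close> increase by at
  most \<open>2 M\<close> per step, starting from \<open>0\<close>.\<close>

lemma contracting_recursion_bound:
  fixes \<delta> :: "nat \<Rightarrow> real"
  assumes M: "0 \<le> M"
    and step: "\<And>k. \<delta> (Suc k) \<le> (1 - ccg_step k) * \<delta> k + (ccg_step k)\<^sup>2 / 2 * M"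
    and k: "1 \<le> k"
  shows "\<delta> k \<le> 2 * M / (real k + 1)"
proof -
  have "real k * (real k + 1) * \<delta> k \<le> 2 * M * real k" for k
  proof (induction k)
    case 0
    show ?case by simp
  next
    case (Suc k)
    define r where "r = real k"
    have r: "0 \<le> r" by (simp add: r_def)
    have "(r + 1) * (r + 2) * \<delta> (Suc k)
        \<le> (r + 1) * (r + 2) * ((1 - ccg_step k) * \<delta> k + (ccg_step k)\<^sup>2 / 2 * M)"
      using r by (intro mult_left_mono step) simp
    also have "\<dots> = r * (r + 1) * \<delta> k + 2 * M * ((r + 1) / (r + 2))"
    proof -
      define s where "s = r + 2"
      have s: "s \<noteq> 0" using r by (simp add: s_def)
      have step_eq: "ccg_step k = 2 / s"
        by (simp add: ccg_step_def r_def s_def)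
      have eqs: "1 - ccg_step k = r / s" "(ccg_step k)\<^sup>2 / 2 = 2 / (s * s)"
        unfolding step_eq using s by (simp_all add: power2_eq_square diff_divide_eq_iff, simp add: s_def)
      show ?thesis
        unfolding eqs s_def[symmetric] using s by (simp add: field_simps)
    qed
    also have "\<dots> \<le> 2 * M * r + 2 * M * 1"
      using Suc r M by (intro add_mono mult_left_mono) (simp_all add: r_def)
    finally show ?case by (simp add: r_def algebra_simps)
  qed
  from this[of k] have "real k * ((real k + 1) * \<delta> k) \<le> real k * (2 * M)"
    by (simp add: mult.assoc mult.commute mult.left_commute)
  then have "(real k + 1) * \<delta> k \<le> 2 * M"
    using k by (simp add: mult_le_cancel_left_pos)
  then show ?thesis by (simp add: field_simps)
qed

section \<open>The convergence rate\<close>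

theorem theorem7:
  fixes B :: "'a::euclidean_space \<Rightarrow>\<^sub>L ('a \<Rightarrow>\<^sub>L real)"
    and F :: "'a \<times> (real^'m) \<Rightarrow> ereal"
    and f :: "'a \<Rightarrow> real^'m"
    and g :: "'m \<Rightarrow> 'a \<Rightarrow> ('a \<Rightarrow>\<^sub>L real)"
    and X :: "'a set"
    and L1 :: "real^'m"
    and x :: "nat \<Rightarrow> 'a"
    and xstar :: 'a
    and k :: nat
  assumes B: "self_adjoint_pos_def B"
    and F_proper: "\<And>z. F z \<noteq> -\<infinity>"
    and F_closed_convex: "closed_convex_ext F"
    and F_mono: "\<And>z u v. (\<forall>i. u $ i \<le> v $ i) \<Longrightarrow> F (z, u) \<le> F (z, v)"
    and X: "open X" "convex X"
    and f_convex: "\<And>i. convex_on X (\<lambda>z. f z $ i)"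
    and f_closed: "\<And>i. closed (epigraph X (\<lambda>z. f z $ i))"
    and f_deriv: "\<And>i z. z \<in> X \<Longrightarrow> ((\<lambda>y. f y $ i) has_derivative blinfun_apply (g i z)) (at z)"
    and f_C1: "\<And>i. continuous_on X (g i)"
    and f_lipschitz: "\<And>i z y. z \<in> X \<Longrightarrow> y \<in> X \<Longrightarrow>
           dual_norm B (g i z - g i y) \<le> L1 $ i * primal_norm B (z - y)"
    and minimizer: "is_arg_min (fc_obj F f X) (\<lambda>z. z \<in> fc_dom F f X) xstar"
    and subhom: "subhomogeneous_on (fc_dom F f X) F"
    and FL_finite: "(SUP z\<in>fc_dom F f X. F (z, L1)) < \<infinity>"
    and dom_convex: "convex (fc_dom F f X)"
    and dom_bounded: "set_diameter B (fc_dom F f X) < \<infinity>"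
    and iterates: "contracting_cond_grad F f g X x"
    and k: "k \<ge> 1"
  shows "fc_obj F f X (x k) - fc_obj F f X xstar
       \<le> 4 * (SUP z\<in>fc_dom F f X. F (z, L1)) * (set_diameter B (fc_dom F f X))\<^sup>2 / ereal (real k)"
proof -
  let ?S = "fc_dom F f X"
  let ?C = "SUP z\<in>?S. F (z, L1)"
  let ?D = "set_diameter B ?S"
  let ?val = "\<lambda>z. real_of_ereal (fc_obj F f X z)"
  have F_conv: "convex (ext_epigraph F)"
    using F_closed_convex by (simp add: closed_convex_ext_def)
  have SX: "?S \<subseteq> X" by (auto simp: fc_dom_def)
  have val: "F (z, f z) = ereal (?val z)" if "z \<in> ?S" for z
    using fc_dom_finite[OF subhom that] by simp
  have xstar: "xstar \<in> ?S"
    using minimizer by (simp add: is_arg_min_def)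
  have x0: "x 0 \<in> ?S"
    and arg_min: "\<And>k. is_arg_min (\<lambda>y. F (y, linearization f g (x k) y))
        (\<lambda>y. x k + (1 / ccg_step k) *\<^sub>R (y - x k) \<in> ?S) (x (Suc k))"
    using iterates by (auto simp: contracting_cond_grad_def)
  have \<gamma>: "0 < ccg_step k" "ccg_step k \<le> 1" for k
    by (simp_all add: ccg_step_def)

  have L1_nonneg: "0 \<le> L1 $ i" for i
  proof (rule lipschitz_constant_nonneg[OF B X(1)])
    show "X \<noteq> {}" using xstar SX by blast
  qed (rule f_lipschitz)
  have FL_nonneg: "0 \<le> F (z, L1)" if "z \<in> ?S" for z
    using subhomogeneous_nonneg[OF subhom that F_mono L1_nonneg] .
  have "0 \<le> ?C" by (rule SUP_upper2[OF xstar]) (rule FL_nonneg[OF xstar])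
  then obtain c where c: "?C = ereal c" "0 \<le> c"
    using FL_finite by (cases ?C) auto
  have FL_le: "F (z, L1) \<le> ereal c" if "z \<in> ?S" for z
    using SUP_upper[OF that, of "\<lambda>z. F (z, L1)"] c by simp

  have dist_le: "ereal (primal_norm B (z - w)) \<le> ?D" if "z \<in> ?S" "w \<in> ?S" for z w
    unfolding set_diameter_def by (rule SUP_upper2[OF that(1) SUP_upper2[OF that(2)]]) simp
  have "0 \<le> ?D" using dist_le[OF xstar xstar] by (simp add: primal_norm_def zero_ereal_def)
  then obtain d where d: "?D = ereal d" "0 \<le> d"
    using dom_bounded by (cases ?D) auto

  \<comment> \<open>Feasibility of the next iterate says precisely that \<open>w k\<close> lies in the domain.\<close>
  define w where "w k = x k + (1 / ccg_step k) *\<^sub>R (x (Suc k) - x k)" for k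
  have w: "w k \<in> ?S" for k
    using arg_min[of k] by (simp add: is_arg_min_def w_def)
  have x_Suc: "x (Suc k) = (1 - ccg_step k) *\<^sub>R x k + ccg_step k *\<^sub>R w k" for k
    using \<gamma>[of k] by (simp add: w_def algebra_simps)
  have xS: "x k \<in> ?S" for k
  proof (induction k)
    case (Suc k)
    then show ?case
      unfolding x_Suc using w[of k] \<gamma>[of k] by (intro convexD[OF dom_convex]) auto
  qed (rule x0)

  define \<delta> where "\<delta> k = ?val (x k) - ?val xstar" for k
  have step: "\<delta> (Suc k) \<le> (1 - ccg_step k) * \<delta> k + (ccg_step k)\<^sup>2 / 2 * (c * d\<^sup>2)" for k
  proof -
    let ?\<gamma> = "ccg_step k" and ?lin = "linearization f g (x k)"
    let ?y = "(1 - ?\<gamma>) *\<^sub>R x k + ?\<gamma> *\<^sub>R xstar"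
    have yS: "?y \<in> ?S"
      using xS[of k] xstar \<gamma>[of k] by (intro convexD[OF dom_convex]) auto
    have "x k + (1 / ?\<gamma>) *\<^sub>R (?y - x k) = xstar"
      using \<gamma>[of k] by (simp add: algebra_simps)
    then have "F (x (Suc k), ?lin (x (Suc k))) \<le> F (?y, ?lin ?y)"
      using arg_min[of k] xstar by (auto simp: is_arg_min_linorder)
    also have "\<dots> \<le> F (?y, f ?y)"
    proof (intro F_mono allI)
      fix i
      show "?lin ?y $ i \<le> f ?y $ i"
        using convex_on_above_tangent_blinfun[OF X(1) f_convex f_deriv, of "x k" ?y i] xS yS SX
        by (auto simp: linearization_def)
    qed
    also have "\<dots> \<le> ereal ((1 - ?\<gamma>) * ?val (x k) + ?\<gamma> * ?val xstar)"
      using xS xstar SX \<gamma>[of k] val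
      by (intro monotone_composite_convex[OF F_conv F_mono f_convex]) (auto simp: less_imp_le)
    finally have model:
      "F (x (Suc k), ?lin (x (Suc k))) \<le> ereal ((1 - ?\<gamma>) * ?val (x k) + ?\<gamma> * ?val xstar)" .

    define e where "e = (primal_norm B (x (Suc k) - x k))\<^sup>2 / 2"
    have e_nonneg: "0 \<le> e" by (simp add: e_def)
    have "x (Suc k) - x k = ?\<gamma> *\<^sub>R (w k - x k)"
      by (simp add: x_Suc algebra_simps)
    then have "primal_norm B (x (Suc k) - x k) = ?\<gamma> * primal_norm B (w k - x k)"
      using \<gamma>[of k] by (simp add: primal_norm_scaleR)
    also have "\<dots> \<le> ?\<gamma> * d"
      using dist_le[OF w xS] d \<gamma>[of k] by (simp add: mult_left_mono)
    finally have e_le: "e \<le> ?\<gamma>\<^sup>2 / 2 * d\<^sup>2"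
      using power_mono[OF _ primal_norm_nonneg[OF B], where n = 2]
      by (fastforce simp: e_def power_mult_distrib)

    have "ereal (?val (x (Suc k))) = F (x (Suc k), f (x (Suc k)))"
      using val[OF xS] by simp
    also have "\<dots> \<le> F (x (Suc k), ?lin (x (Suc k)) + e *\<^sub>R L1)"
    proof (intro F_mono allI)
      fix i
      show "f (x (Suc k)) $ i \<le> (?lin (x (Suc k)) + e *\<^sub>R L1) $ i"
        using lipschitz_gradient_upper_bound[OF B X(2) f_deriv f_lipschitz,
            of "x k" "x (Suc k)" i] xS SX
        by (auto simp: linearization_def e_def mult.commute)
    qed
    also have "\<dots> \<le> F (x (Suc k), ?lin (x (Suc k))) + ereal e * F (x (Suc k), L1)"
      using subhom xS[of "Suc k"] e_nonneg by (auto simp: subhomogeneous_on_def)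
    also have "\<dots> \<le> ereal ((1 - ?\<gamma>) * ?val (x k) + ?\<gamma> * ?val xstar) + ereal e * ereal c"
      using model FL_le[OF xS] e_nonneg by (intro add_mono ereal_mult_left_mono) auto
    finally have "?val (x (Suc k)) \<le> (1 - ?\<gamma>) * ?val (x k) + ?\<gamma> * ?val xstar + e * c"
      by simp
    also have "e * c \<le> ?\<gamma>\<^sup>2 / 2 * d\<^sup>2 * c"
      by (rule mult_right_mono[OF e_le c(2)])
    finally show ?thesis by (simp add: \<delta>_def algebra_simps)
  qed

  have "\<delta> k \<le> 2 * (c * d\<^sup>2) / (real k + 1)"
    using contracting_recursion_bound[OF _ step k] c(2) by simp
  also have "\<dots> \<le> 4 * (c * d\<^sup>2) / real k"
    using k c(2) by (intro frac_le) auto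
  finally have "ereal (?val (x k) - ?val xstar) \<le> ereal (4 * c * d\<^sup>2 / real k)"
    by (simp add: \<delta>_def mult.assoc)
  moreover have "fc_obj F f X (x k) = ereal (?val (x k))" "fc_obj F f X xstar = ereal (?val xstar)"
    using fc_dom_finite(1)[OF subhom] xS xstar by blast+
  moreover have "4 * ?C * ?D\<^sup>2 / ereal (real k) = ereal (4 * c * d\<^sup>2 / real k)"
    using k by (simp add: c(1) d(1) power2_eq_square)
  ultimately show ?thesis by (metis ereal_minus(1))
qed

end
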